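(* Let $r\ge2$, let $a_1,\dots,a_r$ be positive integers, and consider the pure model $\xi(x_1,\dots,x_r)=\prod_{s\in\mathscr S}x_s^{a_s}$, $\vec h=\vec0$, with $\lambda_s=\frac{a_s}{\sum_{s'\in\mathscr S}a_{s'}}$ for all $s\in\mathscr S$. Then $\Phi(q)=(q,\dots,q)$ uniquely maximizes $\mathbb A$, and $$\mathsf{ALG}=2\sqrt{\frac{\big(\sum_{s\in\mathscr S}a_s\big)-1}{\sum_{s\in\mathscr S}a_s}}.$$
   Context: Here $\mathscr S=\{1,\dots,r\}$ and $\xi^s(\vec x)=\lambda_s^{-1}\partial_{x_s}\xi(\vec x)$. For $0\le q_0\le1$, $\mathbb I(q_0,1)$ is the set of increasing (i.e. nondecreasing), continuously differentiable functions $[q_0,1]\to[0,1]$, and $\mathrm{Adm}(q_0,1)$ is the set of $\Phi=(\Phi_s)_s\in\mathbb I(q_0,1)^{\mathscr S}$ with $\sum_s\lambda_s\Phi_s(q)=q$ for all $q$. With $(p\times\xi^s\circ\Phi)(q)=p(q)\xi^s(\Phi(q))$ and (since $\vec h=\vec0$) $$\mathbb A(p,\Phi;q_0)=\sum_{s}\lambda_s\int_{q_0}^1\sqrt{\Phi_s'(q)(p\times\xi^s\circ\Phi)'(q)}\,dq,\qquad\mathsf{ALG}=\sup_{q_0\in[0,1]}\sup_{p\in\mathbb I(q_0,1),\,\Phi\in\mathrm{Adm}(q_0,1)}\mathbb A(p,\Phi;q_0).$$ "$\Phi$ uniquely maximizes $\mathbb A$" means: together with $p\equiv1$ and $q_0=0$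 it attains $\mathsf{ALG}$, and the maximizer is unique (up to reparametrization of time $q\mapsto\alpha(q)$). *)

theory Defs
  imports "HOL-Analysis.Analysis"
begin

text \<open>
  Variational problem for the algorithmic threshold of a multi-species spherical spin glass with
  species \<open>{1..r}\<close>, species proportions \<open>lam s\<close> and zero external field. A vector indexed by the
  species is a function on \<open>nat\<close> of which only the values on \<open>{1..r}\<close> matter; likewise a function
  on \<open>[q0,1]\<close> is a function on \<open>real\<close> of which only the values on \<open>{q0..1}\<close> matter.
\<close>

text \<open>
  Derivatives are taken within \<open>{q0..1}\<close>, i.e. one-sided at the endpoints, so that values
  outside the interval play no role (\<open>C1_differentiable_on\<close> would use two-sided ones).
\<close>

definition increasing_C1 :: "real \<Rightarrow> (real \<Rightarrow> real) set" where
  "increasing_C1 q0 = {f. f ` {q0..1} \<subseteq> {0..1} \<and> mono_on {q0..1} f \<and>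
     (\<exists>f'. continuous_on {q0..1} f' \<and>
        (\<forall>q\<in>{q0..1}. (f has_real_derivative f' q) (at q within {q0..1})))}"

definition Adm :: "nat \<Rightarrow> (nat \<Rightarrow> real) \<Rightarrow> real \<Rightarrow> (nat \<Rightarrow> real \<Rightarrow> real) set" where
  "Adm r lam q0 = {\<Phi>. (\<forall>s\<in>{1..r}. \<Phi> s \<in> increasing_C1 q0) \<and>
     (\<forall>q\<in>{q0..1}. (\<Sum>s=1..r. lam s * \<Phi> s q) = q)}"

definition partial_deriv :: "nat \<Rightarrow> ((nat \<Rightarrow> real) \<Rightarrow> real) \<Rightarrow> (nat \<Rightarrow> real) \<Rightarrow> real" where
  "partial_deriv s \<xi> x = deriv (\<lambda>t. \<xi> (x(s := t))) (x s)"

definition xi_species ::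
    "(nat \<Rightarrow> real) \<Rightarrow> ((nat \<Rightarrow> real) \<Rightarrow> real) \<Rightarrow> nat \<Rightarrow> (nat \<Rightarrow> real) \<Rightarrow> real" where
  "xi_species lam \<xi> s x = inverse (lam s) * partial_deriv s \<xi> x"

definition alg_functional ::
    "nat \<Rightarrow> (nat \<Rightarrow> real) \<Rightarrow> ((nat \<Rightarrow> real) \<Rightarrow> real) \<Rightarrow>
     (real \<Rightarrow> real) \<Rightarrow> (nat \<Rightarrow> real \<Rightarrow> real) \<Rightarrow> real \<Rightarrow> real" where
  "alg_functional r lam \<xi> p \<Phi> q0 =
     (\<Sum>s=1..r. lam s * integral {q0..1} (\<lambda>q. sqrt
        (vector_derivative (\<Phi> s) (at q within {q0..1}) *
         vector_derivative (\<lambda>u. p u * xi_species lam \<xi> s (\<lambda>t. \<Phi> t u)) (at q within {q0..1}))))"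

text \<open>The suprema are taken in \<open>ereal\<close>, so that their existence is not presupposed.\<close>

definition ALG :: "nat \<Rightarrow> (nat \<Rightarrow> real) \<Rightarrow> ((nat \<Rightarrow> real) \<Rightarrow> real) \<Rightarrow> ereal" where
  "ALG r lam \<xi> = (SUP q0\<in>{0..1}. SUP (p, \<Phi>)\<in>increasing_C1 q0 \<times> Adm r lam q0.
     ereal (alg_functional r lam \<xi> p \<Phi> q0))"

text \<open>
  The triple \<open>(q0, p, \<Phi>) = (0, 1, \<Phi>)\<close> attains the supremum and is the only one to do so.
  Uniqueness up to reparametrization of time is literal equality here, because the
  normalization in \<open>Adm\<close> determines the parametrization.
\<close>

definition uniquely_maximizes ::
    "nat \<Rightarrow> (nat \<Rightarrow> real) \<Rightarrow> ((nat \<Rightarrow> real) \<Rightarrow> real) \<Rightarrow> (nat \<Rightarrow> real \<Rightarrow> real) \<Rightarrow> bool" where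
  "uniquely_maximizes r lam \<xi> \<Phi> \<longleftrightarrow>
     \<Phi> \<in> Adm r lam 0 \<and>
     ereal (alg_functional r lam \<xi> (\<lambda>_. 1) \<Phi> 0) = ALG r lam \<xi> \<and>
     (\<forall>q0\<in>{0..1}. \<forall>p\<in>increasing_C1 q0. \<forall>\<Psi>\<in>Adm r lam q0.
        ereal (alg_functional r lam \<xi> p \<Psi> q0) = ALG r lam \<xi> \<longrightarrow>
          q0 = 0 \<and> (\<forall>q\<in>{0..1}. p q = 1) \<and> (\<forall>s\<in>{1..r}. \<forall>q\<in>{0..1}. \<Psi> s q = \<Phi> s q))"

definition pure_model :: "nat \<Rightarrow> (nat \<Rightarrow> nat) \<Rightarrow> (nat \<Rightarrow> real) \<Rightarrow> real" where
  "pure_model r a x = (\<Prod>s=1..r. x s ^ a s)"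

end

theory Submission
  imports Defs
begin

text \<open>
  Write \<open>A = a 1 + \<dots> + a r\<close> and \<open>F = p * (\<Prod>s. \<Phi> s ^ a s)\<close>. The upper bound is a calibration argument:
  along every admissible path the integrand is at most the derivative of
  \<open>H = 2 * sqrt ((A - 1) / A) * sqrt F\<close>, and \<open>0 \<le> H \<le> 2 * sqrt ((A - 1) / A)\<close> because \<open>0 \<le> F \<le> 1\<close>.

  Since \<open>p * \<xi>\<^sup>s \<circ> \<Phi> = A * F / \<Phi> s\<close>, with \<open>u s = (ln (\<Phi> s))'\<close>, \<open>v = (ln p)'\<close> and
  \<open>c = (ln F)' = v + (\<Sum>s. a s * u s)\<close> the integrand equals
  \<open>\<Sum>s. a s / A * sqrt (A * F * u s * (c - u s))\<close> wherever \<open>F > 0\<close>. The inequality between the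
  geometric and the arithmetic mean of \<open>(A - 1) * u s\<close> and \<open>c - u s\<close>, summed with the weights
  \<open>a s / A\<close>, bounds it by \<open>sqrt ((A - 1) / A) * sqrt F * c = H'\<close>; this is \<open>sum_sqrt_bound\<close>, and
  equality forces \<open>A * u s = c\<close> for all \<open>s\<close> and hence \<open>v = 0\<close>. By monotonicity \<open>F\<close> vanishes up to
  some time \<open>z\<close> and is positive afterwards; before \<open>z\<close> the integrand vanishes (\<open>g_zero\<close>). So
  \<open>D = H - (integral of the integrand)\<close> is nondecreasing (\<open>D_mono\<close>), which is the bound.

  If a path attains the bound, then \<open>D\<close> is identically zero, so \<open>F q0 = 0\<close>, \<open>F 1 = 1\<close>, and equality
  holds throughout \<open>(z, 1)\<close>. There \<open>p\<close> is constant and all \<open>\<Phi> s\<close> have the same logarithmic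
  derivative, which by the normalization \<open>(\<Sum>s. lam s * \<Phi> s q) = q\<close> is \<open>1 / q\<close>. Therefore
  \<open>p = 1\<close> and \<open>\<Phi> s q = q\<close> on \<open>[z, 1]\<close>; then \<open>0 = F z = z ^ A\<close> gives \<open>z = 0\<close>, and so \<open>q0 = 0\<close>
  (\<open>maximizer_unique\<close>).
\<close>

section \<open>Increasing continuously differentiable functions\<close>

text \<open>The derivative within \<open>{q0..1}\<close>, as used by the functional; one-sided at the endpoints.\<close>

abbreviation der :: "real \<Rightarrow> (real \<Rightarrow> real) \<Rightarrow> real \<Rightarrow> real" where
  "der q0 f q \<equiv> vector_derivative f (at q within {q0..1})"

lemma increasing_C1_has_derivative:
  assumes "f \<in> increasing_C1 q0" "q0 < 1" "q \<in> {q0..1}"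
  shows "(f has_real_derivative der q0 f q) (at q within {q0..1})"
proof -
  obtain f' where "(f has_vector_derivative f' q) (at q within {q0..1})"
    using assms(1,3) unfolding increasing_C1_def has_real_derivative_iff_has_vector_derivative
    by blast
  then show ?thesis
    using vector_derivative_within_closed_interval[of q0 1 q f] assms(2,3)
    by (simp add: has_real_derivative_iff_has_vector_derivative)
qed

lemma increasing_C1_continuous_der:
  assumes "f \<in> increasing_C1 q0" "q0 < 1"
  shows "continuous_on {q0..1} (der q0 f)"
proof -
  obtain f' where f': "continuous_on {q0..1} f'"
      "\<forall>q\<in>{q0..1}. (f has_real_derivative f' q) (at q within {q0..1})"
    using assms(1) unfolding increasing_C1_def by auto
  have "der q0 f q = f' q" if "q \<in> {q0..1}" for q
    using f'(2) that assms(2)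
    by (auto simp: has_real_derivative_iff_has_vector_derivative
      intro!: vector_derivative_within_closed_interval)
  then show ?thesis using f'(1) by (subst continuous_on_cong[OF refl])
qed

lemma increasing_C1_DERIV:
  assumes "f \<in> increasing_C1 q0" "q0 < q" "q < 1"
  shows "(f has_real_derivative der q0 f q) (at q)"
  using increasing_C1_has_derivative[OF assms(1), of q] assms(2,3)
  by (simp add: at_within_Icc_at)

lemma increasing_C1_continuous:
  assumes "f \<in> increasing_C1 q0"
  shows "continuous_on {q0..1} f"
  using assms unfolding increasing_C1_def by (blast intro: DERIV_continuous_on)

lemma increasing_C1_range:
  assumes "f \<in> increasing_C1 q0" "q \<in> {q0..1}"
  shows "0 \<le> f q" "f q \<le> 1"
  using assms unfolding increasing_C1_def by (auto simp: image_subset_iff)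

lemma increasing_C1_mono:
  assumes "f \<in> increasing_C1 q0" "q0 \<le> x" "x \<le> y" "y \<le> 1"
  shows "f x \<le> f y"
  using assms unfolding increasing_C1_def mono_on_def by auto

lemma increasing_C1_der_nonneg:
  assumes "f \<in> increasing_C1 q0" "q0 < q" "q < 1"
  shows "0 \<le> der q0 f q"
proof (rule mono_on_imp_deriv_nonneg)
  show "mono_on {q0..1} f" using assms(1) by (simp add: increasing_C1_def)
  show "(f has_real_derivative der q0 f q) (at q)" by (rule increasing_C1_DERIV[OF assms])
  show "q \<in> interior {q0..1}" using assms by simp
qed

text \<open>A zero in the interior is a local minimum.\<close>

lemma increasing_C1_der_zero:
  assumes "f \<in> increasing_C1 q0" "q0 < q" "q < 1" "f q = 0"
  shows "der q0 f q = 0"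
proof (rule DERIV_local_min)
  show "(f has_real_derivative der q0 f q) (at q)" by (rule increasing_C1_DERIV[OF assms(1-3)])
  show "0 < min (q - q0) (1 - q)" using assms by simp
  show "\<forall>y. \<bar>q - y\<bar> < min (q - q0) (1 - q) \<longrightarrow> f q \<le> f y"
    using increasing_C1_range(1)[OF assms(1)] assms(4) by (auto simp: abs_less_iff)
qed

lemma increasing_C1_const:
  assumes "0 \<le> c" "c \<le> 1"
  shows "(\<lambda>_. c) \<in> increasing_C1 q0"
  unfolding increasing_C1_def using assms
  by (auto simp: mono_on_def intro!: exI[of _ "\<lambda>_. 0"])

lemma increasing_C1_mult:
  assumes f: "f \<in> increasing_C1 q0" and g: "g \<in> increasing_C1 q0"
  shows "(\<lambda>q. f q * g q) \<in> increasing_C1 q0"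
proof -
  obtain f' where f': "continuous_on {q0..1} f'"
      "\<forall>q\<in>{q0..1}. (f has_real_derivative f' q) (at q within {q0..1})"
    using f unfolding increasing_C1_def by auto
  obtain g' where g': "continuous_on {q0..1} g'"
      "\<forall>q\<in>{q0..1}. (g has_real_derivative g' q) (at q within {q0..1})"
    using g unfolding increasing_C1_def by auto
  have "mono_on {q0..1} (\<lambda>q. f q * g q)"
    using increasing_C1_mono[OF f] increasing_C1_mono[OF g]
      increasing_C1_range[OF f] increasing_C1_range[OF g]
    by (auto intro!: mono_onI mult_mono)
  moreover have "(\<lambda>q. f q * g q) ` {q0..1} \<subseteq> {0..1}"
    using increasing_C1_range[OF f] increasing_C1_range[OF g]
    by (auto intro!: mult_le_one)
  moreover have "continuous_on {q0..1} (\<lambda>q. f q * g' q + f' q * g q)"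
    by (intro continuous_intros f' g' increasing_C1_continuous f g)
  moreover have "\<forall>q\<in>{q0..1}. ((\<lambda>q. f q * g q) has_real_derivative f q * g' q + f' q * g q)
      (at q within {q0..1})"
    using f' g' by (auto intro!: DERIV_mult')
  ultimately show ?thesis unfolding increasing_C1_def by blast
qed

lemma increasing_C1_power:
  assumes "f \<in> increasing_C1 q0"
  shows "(\<lambda>q. f q ^ n) \<in> increasing_C1 q0"
  by (induction n) (auto intro: increasing_C1_const increasing_C1_mult assms)

lemma increasing_C1_prod:
  assumes "finite S" "\<And>s. s \<in> S \<Longrightarrow> f s \<in> increasing_C1 q0"
  shows "(\<lambda>q. \<Prod>s\<in>S. f s q) \<in> increasing_C1 q0"
  using assms by (induction S rule: finite_induct) (auto intro: increasing_C1_const increasing_C1_mult)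

text \<open>
  The time up to which \<open>f\<close> vanishes. It is \<open>q0\<close> if \<open>f\<close> has no zero at all, so \<open>f z = 0\<close> may fail then.
\<close>

lemma increasing_C1_last_zero:
  assumes f: "f \<in> increasing_C1 q0" and "q0 \<le> 1"
  obtains z where "z \<in> {q0..1}" "f z = 0 \<or> z = q0"
    "\<And>q. q0 \<le> q \<Longrightarrow> q < z \<Longrightarrow> f q = 0" "\<And>q. z < q \<Longrightarrow> q \<le> 1 \<Longrightarrow> 0 < f q"
proof -
  define Z where "Z = insert q0 {q \<in> {q0..1}. f q = 0}"
  have "closed {q \<in> {q0..1}. f q = 0}"
    using continuous_closed_preimage_constant[OF increasing_C1_continuous[OF f], of 0] by simp
  then have "compact Z"
    unfolding Z_def by (intro compact_insert compact_Int_closed[of "{q0..1}", simplified Int_def, simplified])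
      (auto simp: compact_eq_bounded_closed intro: bounded_subset[of "{q0..1}"])
  moreover have "Z \<noteq> {}" by (simp add: Z_def)
  ultimately obtain z where z: "z \<in> Z" "\<And>q. q \<in> Z \<Longrightarrow> q \<le> z"
    using compact_attains_sup by metis
  have zI: "z \<in> {q0..1}" "f z = 0 \<or> z = q0" using z(1) \<open>q0 \<le> 1\<close> by (auto simp: Z_def)
  show ?thesis
  proof (rule that[OF zI])
    fix q assume q: "q0 \<le> q" "q < z"
    then have "f z = 0" using zI by auto
    then show "f q = 0"
      using increasing_C1_mono[OF f, of q z] increasing_C1_range(1)[OF f, of q] q zI by auto
  next
    fix q assume q: "z < q" "q \<le> 1"
    then have "q \<notin> Z" using z(2)[of q] by auto
    then have "f q \<noteq> 0" using q zI by (auto simp: Z_def)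
    then show "0 < f q" using increasing_C1_range(1)[OF f, of q] q zI by auto
  qed
qed

section \<open>The pointwise inequality\<close>

lemma sqrt_mult_eq_mean_imp_eq:
  fixes x y :: real
  assumes "0 \<le> x" "0 \<le> y" "sqrt (x * y) = (x + y) / 2"
  shows "x = y"
proof -
  have "x * y = ((x + y) / 2)\<^sup>2"
    using assms by (metis real_sqrt_pow2 mult_nonneg_nonneg)
  then have "(x - y)\<^sup>2 = 0" by (simp add: power2_eq_square field_simps)
  then show ?thesis by simp
qed

text \<open>
  Comparison of the integrand with the derivative of \<open>2 * sqrt ((A - 1) / A) * sqrt F\<close>, in terms of
  logarithmic derivatives. The reason is the arithmetic-geometric mean inequality for
  \<open>(A - 1) * u s\<close> and \<open>c - u s\<close>, which are equal for the diagonal path.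
\<close>

lemma sum_sqrt_bound:
  fixes a u :: "'s \<Rightarrow> real"
  assumes fin: "finite S" and A: "(\<Sum>s\<in>S. a s) = A" "2 \<le> A"
    and a: "\<And>s. s \<in> S \<Longrightarrow> 1 \<le> a s" and u: "\<And>s. s \<in> S \<Longrightarrow> 0 \<le> u s"
    and v: "0 \<le> v" and c: "c = v + (\<Sum>s\<in>S. a s * u s)" and F: "0 < F"
  defines "L \<equiv> \<Sum>s\<in>S. a s / A * sqrt (A * F * (u s * (c - u s)))"
    and "R \<equiv> sqrt ((A - 1) / A) * (sqrt F * c)"
  shows "L \<le> R" and "L = R \<Longrightarrow> s \<in> S \<Longrightarrow> A * u s = c"
proof -
  define K where "K = sqrt (A * F / (A - 1))"
  have K: "0 < K" using A F by (simp add: K_def)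
  \<comment> \<open>The exponents are at least 1, so each \<open>u s\<close> is dominated by the weighted sum.\<close>
  have uc: "u s \<le> c" if "s \<in> S" for s
  proof -
    have "u s \<le> a s * u s" using mult_right_mono[OF a u] that by fastforce
    also have "\<dots> \<le> (\<Sum>s\<in>S. a s * u s)"
      using that fin a u by (intro member_le_sum) (auto intro!: mult_nonneg_nonneg intro: order_trans[OF zero_le_one])
    finally show ?thesis using c v by simp
  qed
  have split: "sqrt (A * F * (u s * (c - u s))) = K * sqrt ((A - 1) * u s * (c - u s))" for s
    unfolding K_def real_sqrt_mult[symmetric] using A by (simp add: field_simps)
  let ?m = "\<lambda>s. ((A - 1) * u s + (c - u s)) / 2"
  have le: "sqrt ((A - 1) * u s * (c - u s)) \<le> ?m s" if "s \<in> S" for s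
    using arith_geo_mean_sqrt[of "(A - 1) * u s" "c - u s"] uc[OF that] u[OF that] A by simp
  have term_le: "a s / A * sqrt (A * F * (u s * (c - u s))) \<le> a s / A * (K * ?m s)"
    if "s \<in> S" for s
    unfolding split using le[OF that] K a[OF that] A by (intro mult_left_mono) auto
  have "(\<Sum>s\<in>S. a s / A * (K * ?m s)) = (\<Sum>s\<in>S. K / (2 * A) * ((A - 2) * (a s * u s) + a s * c))"
    by (intro sum.cong refl) (simp add: field_simps)
  also have "\<dots> = K / (2 * A) * ((A - 2) * (c - v) + A * c)"
    by (simp only: sum_distrib_left[symmetric] sum_distrib_right[symmetric] sum.distrib A(1) c) simp
  finally have mean: "(\<Sum>s\<in>S. a s / A * (K * ?m s)) = K / (2 * A) * ((A - 2) * (c - v) + A * c)" .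
  have "sqrt ((A - 1) / A) * sqrt F = sqrt (((A - 1) / A)\<^sup>2 * (A * F / (A - 1)))"
    unfolding real_sqrt_mult[symmetric] using A by (simp add: field_simps power2_eq_square)
  also have "\<dots> = (A - 1) / A * K"
    using A by (subst real_sqrt_mult) (simp add: K_def)
  finally have "R = (A - 1) / A * K * c" unfolding R_def by (simp only: mult.assoc[symmetric])
  then have R: "R = K / (2 * A) * ((A - 2) * c + A * c)"
    using A by (simp add: field_simps)
  \<comment> \<open>The two sides differ by a nonnegative multiple of \<open>(A - 2) * v\<close>.\<close>
  have mean_le: "(\<Sum>s\<in>S. a s / A * (K * ?m s)) \<le> R"
    unfolding mean R using K A v by (intro mult_left_mono add_right_mono) auto
  have sum_le: "L \<le> (\<Sum>s\<in>S. a s / A * (K * ?m s))" unfolding L_def by (intro sum_mono term_le)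
  show "L \<le> R" using sum_le mean_le by simp
  assume "L = R" "s \<in> S"
  then have "L = (\<Sum>s\<in>S. a s / A * (K * ?m s))" using sum_le mean_le by simp
  then have "a s / A * sqrt (A * F * (u s * (c - u s))) = a s / A * (K * ?m s)"
    unfolding L_def by (rule sum_mono_inv) (use term_le fin \<open>s \<in> S\<close> in auto)
  moreover have "a s / A \<noteq> 0" "K \<noteq> 0" using K a[OF \<open>s \<in> S\<close>] A(2) by auto
  ultimately have mean_eq: "sqrt ((A - 1) * u s * (c - u s)) = ?m s"
    unfolding split by (metis mult_left_cancel)
  have "(A - 1) * u s = c - u s"
    by (rule sqrt_mult_eq_mean_imp_eq[OF _ _ mean_eq]) (use uc u \<open>s \<in> S\<close> A(2) in auto)
  then show "A * u s = c" by (simp add: algebra_simps)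
qed

section \<open>The functional of a pure model\<close>

lemma xi_species_pure_model:
  assumes s: "s \<in> {1..r}" and "lam s = real (a s) / A" "a s > 0"
  shows "xi_species lam (pure_model r a) s x =
    A * (x s ^ (a s - 1) * (\<Prod>t\<in>{1..r}-{s}. x t ^ a t))"
proof -
  have "pure_model r a (x(s := t)) = t ^ a s * (\<Prod>t\<in>{1..r}-{s}. x t ^ a t)" for t
    unfolding pure_model_def by (subst prod.remove[OF _ s]) (auto intro!: prod.cong)
  then have "((\<lambda>t. pure_model r a (x(s := t))) has_real_derivative
      real (a s) * x s ^ (a s - 1) * (\<Prod>t\<in>{1..r}-{s}. x t ^ a t)) (at (x s))"
    by (auto intro!: derivative_eq_intros)
  then have "partial_deriv s (pure_model r a) x =
      real (a s) * x s ^ (a s - 1) * (\<Prod>t\<in>{1..r}-{s}. x t ^ a t)"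
    unfolding partial_deriv_def by (rule DERIV_imp_deriv)
  then show ?thesis using assms by (simp add: xi_species_def)
qed

text \<open>The product rule in logarithmic form: \<open>u s\<close> is the logarithmic derivative of \<open>f s\<close>.\<close>

lemma has_derivative_prod_power:
  fixes f :: "'s \<Rightarrow> real \<Rightarrow> real"
  assumes "finite S" "\<And>s. s \<in> S \<Longrightarrow> (f s has_real_derivative u s * f s q) (at q)"
  shows "((\<lambda>q. \<Prod>s\<in>S. f s q ^ a s) has_real_derivative
    (\<Sum>s\<in>S. real (a s) * u s) * (\<Prod>s\<in>S. f s q ^ a s)) (at q)"
  using assms
proof (induction S rule: finite_induct)
  case (insert s S)
  have "((\<lambda>q. f s q ^ a s) has_real_derivative real (a s) * u s * f s q ^ a s) (at q)"
  proof (cases "a s")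
    case (Suc n)
    then show ?thesis
      using DERIV_power_Suc[OF insert.prems[of s], of n] by (simp add: algebra_simps)
  qed simp
  from DERIV_mult'[OF this insert.IH[OF insert.prems]] show ?case
    using insert.hyps by (simp add: algebra_simps)
qed auto

text \<open>
  A competitor \<open>(q0, p, \<Phi>)\<close> in the variational problem of a pure model of degree \<open>A\<close>. The case
  \<open>q0 = 1\<close>, where the functional is zero and one-sided derivatives are meaningless, is excluded.
\<close>

locale pure_path =
  fixes r :: nat and a :: "nat \<Rightarrow> nat" and lam :: "nat \<Rightarrow> real" and A :: real
    and q0 :: real and p :: "real \<Rightarrow> real" and \<Phi> :: "nat \<Rightarrow> real \<Rightarrow> real"
  assumes a_pos: "\<And>s. s \<in> {1..r} \<Longrightarrow> a s > 0"
    and A_eq: "A = (\<Sum>s=1..r. real (a s))" and A_ge_2: "2 \<le> A"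
    and lam_eq: "\<And>s. s \<in> {1..r} \<Longrightarrow> lam s = real (a s) / A"
    and q0: "0 \<le> q0" "q0 < 1"
    and p: "p \<in> increasing_C1 q0" and Phi: "\<Phi> \<in> Adm r lam q0"
begin

text \<open>The function \<open>p * (\<xi> \<circ> \<Phi>)\<close>.\<close>

definition F :: "real \<Rightarrow> real" where
  "F q = p q * (\<Prod>s=1..r. \<Phi> s q ^ a s)"

text \<open>
  \<open>A * m s\<close> is the function \<open>p * \<xi>\<^sup>s \<circ> \<Phi>\<close>. Division by \<open>\<Phi> s\<close> is avoided, so that it is again
  an increasing continuously differentiable function even where \<open>\<Phi> s\<close> vanishes.
\<close>

definition m :: "nat \<Rightarrow> real \<Rightarrow> real" where
  "m s q = p q * (\<Phi> s q ^ (a s - 1) * (\<Prod>t\<in>{1..r}-{s}. \<Phi> t q ^ a t))"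

text \<open>The integrand of the functional, summed over the species.\<close>

definition g :: "real \<Rightarrow> real" where
  "g q = (\<Sum>s=1..r. lam s * sqrt (der q0 (\<Phi> s) q * (A * der q0 (m s) q)))"

text \<open>The calibrating potential; \<open>H' = g\<close> along the diagonal path with \<open>p = 1\<close>.\<close>

definition H :: "real \<Rightarrow> real" where
  "H q = 2 * sqrt ((A - 1) / A) * sqrt (F q)"

text \<open>The potential minus the part of the functional accumulated up to time \<open>q\<close>.\<close>

definition D :: "real \<Rightarrow> real" where
  "D q = H q - integral {q0..q} g"

lemma Phi_C1: "s \<in> {1..r} \<Longrightarrow> \<Phi> s \<in> increasing_C1 q0"
  using Phi by (simp add: Adm_def)

lemma Phi_sum: "q \<in> {q0..1} \<Longrightarrow> (\<Sum>s=1..r. lam s * \<Phi> s q) = q"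
  using Phi by (simp add: Adm_def)

lemma lam_pos: "s \<in> {1..r} \<Longrightarrow> 0 < lam s"
  using a_pos lam_eq A_ge_2 by simp

lemma lam_sum: "(\<Sum>s=1..r. lam s) = 1"
proof -
  have "(\<Sum>s=1..r. lam s) = (\<Sum>s=1..r. real (a s) / A)" by (intro sum.cong refl lam_eq)
  then show ?thesis using A_eq A_ge_2 by (simp add: sum_divide_distrib[symmetric])
qed

lemma F_C1: "F \<in> increasing_C1 q0"
  unfolding F_def[abs_def]
  by (intro increasing_C1_mult increasing_C1_prod increasing_C1_power p Phi_C1) auto

lemma m_C1: "s \<in> {1..r} \<Longrightarrow> m s \<in> increasing_C1 q0"
  unfolding m_def[abs_def]
  by (intro increasing_C1_mult increasing_C1_prod increasing_C1_power p Phi_C1) auto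

lemma m_mult_Phi: "s \<in> {1..r} \<Longrightarrow> m s q * \<Phi> s q = F q"
  using a_pos[of s] unfolding m_def F_def
  by (subst prod.remove[of "{1..r}" s]) (auto simp: power_eq_if)

lemma g_continuous: "continuous_on {q0..1} g"
  unfolding g_def[abs_def]
  by (intro continuous_intros increasing_C1_continuous_der Phi_C1 m_C1 q0)

lemma alg_functional_eq: "alg_functional r lam (pure_model r a) p \<Phi> q0 = integral {q0..1} g"
proof -
  have "integral {q0..1} (\<lambda>q. sqrt (der q0 (\<Phi> s) q *
      der q0 (\<lambda>u. p u * xi_species lam (pure_model r a) s (\<lambda>t. \<Phi> t u)) q)) =
    integral {q0..1} (\<lambda>q. sqrt (der q0 (\<Phi> s) q * (A * der q0 (m s) q)))"
    if s: "s \<in> {1..r}" for s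
  proof (rule integral_cong)
    fix q assume q: "q \<in> {q0..1}"
    have eq: "(\<lambda>u. p u * xi_species lam (pure_model r a) s (\<lambda>t. \<Phi> t u)) = (\<lambda>u. A * m s u)"
      by (simp add: xi_species_pure_model[where lam = lam and a = a, OF s lam_eq[OF s] a_pos[OF s]]
          m_def mult_ac)
    have "((\<lambda>u. A * m s u) has_real_derivative A * der q0 (m s) q) (at q within {q0..1})"
      by (intro DERIV_cmult increasing_C1_has_derivative m_C1 s q0 q)
    then show "sqrt (der q0 (\<Phi> s) q *
        der q0 (\<lambda>u. p u * xi_species lam (pure_model r a) s (\<lambda>t. \<Phi> t u)) q) =
        sqrt (der q0 (\<Phi> s) q * (A * der q0 (m s) q))"
      unfolding eq using q q0
      by (simp add: has_real_derivative_iff_has_vector_derivative vector_derivative_within_closed_interval)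
  qed
  then have "alg_functional r lam (pure_model r a) p \<Phi> q0 =
      (\<Sum>s=1..r. integral {q0..1} (\<lambda>q. lam s * sqrt (der q0 (\<Phi> s) q * (A * der q0 (m s) q))))"
    unfolding alg_functional_def by simp
  also have "\<dots> = integral {q0..1} g"
    unfolding g_def[abs_def]
    by (rule integral_sum[symmetric])
      (auto intro!: integrable_continuous_real continuous_intros increasing_C1_continuous_der
        Phi_C1 m_C1 q0)
  finally show ?thesis .
qed

lemma D_continuous: "continuous_on {q0..1} D"
proof -
  have "continuous_on {q0..1} (\<lambda>q. integral {q0..q} g)"
    by (intro indefinite_integral_continuous_1 integrable_continuous_real g_continuous)
  moreover have "continuous_on {q0..1} F" by (rule increasing_C1_continuous[OF F_C1])
  ultimately show ?thesis unfolding D_def[abs_def] H_def by (intro continuous_intros)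
qed

lemma integral_g_DERIV:
  assumes "q0 < q" "q < 1"
  shows "((\<lambda>q. integral {q0..q} g) has_real_derivative g q) (at q)"
  using integral_has_real_derivative[OF g_continuous, of q] assms by (simp add: at_within_Icc_at)

text \<open>
  Where \<open>F = m s * \<Phi> s\<close> vanishes, one of the two factors has an interior minimum, so its
  derivative is zero as well.
\<close>

lemma g_zero:
  assumes q: "q0 < q" "q < 1" and "F q = 0"
  shows "g q = 0"
  unfolding g_def
proof (rule sum.neutral, rule ballI)
  fix s assume s: "s \<in> {1..r}"
  have "m s q = 0 \<or> \<Phi> s q = 0" using m_mult_Phi[OF s, of q] \<open>F q = 0\<close> by simp
  then show "lam s * sqrt (der q0 (\<Phi> s) q * (A * der q0 (m s) q)) = 0"
    using increasing_C1_der_zero[OF Phi_C1[OF s] q] increasing_C1_der_zero[OF m_C1[OF s] q] by auto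
qed

lemma D_DERIV_zero:
  assumes q: "q0 < q" "q < z" "z \<le> 1" and z: "\<And>q. q0 \<le> q \<Longrightarrow> q < z \<Longrightarrow> F q = 0"
  shows "(D has_real_derivative 0) (at q)"
proof -
  have "(H has_real_derivative 0) (at q)"
  proof (rule has_field_derivative_transform_within_open[of "\<lambda>_. 0" 0 q "{q0<..<z}"])
    show "\<And>x. x \<in> {q0<..<z} \<Longrightarrow> 0 = H x" using z by (simp add: H_def)
  qed (use q in auto)
  from DERIV_diff[OF this integral_g_DERIV] show ?thesis
    using g_zero z q unfolding D_def[abs_def] by simp
qed

lemma pos_factors:
  assumes "q \<in> {q0..1}" "0 < F q"
  shows "0 < p q" "s \<in> {1..r} \<Longrightarrow> 0 < \<Phi> s q"
proof -
  have "0 \<noteq> p q" using assms(2) unfolding F_def by auto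
  with increasing_C1_range(1)[OF p assms(1)] show "0 < p q" by simp
  show "0 < \<Phi> s q" if s: "s \<in> {1..r}"
    using m_mult_Phi[OF s, of q] increasing_C1_range(1)[OF Phi_C1[OF s] assms(1)] assms(2)
    by (cases "\<Phi> s q = 0") auto
qed

text \<open>
  The central inequality \<open>D' \<ge> 0\<close> and its case of equality, in terms of the logarithmic derivatives
  of \<open>\<Phi> s\<close>, \<open>p\<close> and \<open>F\<close>.
\<close>

lemma D_DERIV_pos:
  assumes q: "q0 < q" "q < 1" and Fq: "0 < F q"
  obtains d where "(D has_real_derivative d) (at q)" "0 \<le> d"
    "\<And>s. d = 0 \<Longrightarrow> s \<in> {1..r} \<Longrightarrow> A * (der q0 (\<Phi> s) q / \<Phi> s q) = der q0 F q / F q"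
    "d = 0 \<Longrightarrow> der q0 p q = 0"
proof -
  define u where "u s = der q0 (\<Phi> s) q / \<Phi> s q" for s
  define v where "v = der q0 p q / p q"
  define c where "c = v + (\<Sum>s=1..r. real (a s) * u s)"
  define d where "d = sqrt ((A - 1) / A) * (sqrt (F q) * c) - g q"
  have qI: "q \<in> {q0..1}" using q by simp
  note pos = pos_factors[OF qI Fq]
  have Phi_D: "(\<Phi> s has_real_derivative u s * \<Phi> s q) (at q)" if "s \<in> {1..r}" for s
    using increasing_C1_DERIV[OF Phi_C1[OF that] q] pos(2)[OF that] by (simp add: u_def)
  have "(p has_real_derivative v * p q) (at q)"
    using increasing_C1_DERIV[OF p q] pos(1) by (simp add: v_def)
  moreover have "((\<lambda>q. \<Prod>s=1..r. \<Phi> s q ^ a s) has_real_derivative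
      (\<Sum>s=1..r. real (a s) * u s) * (\<Prod>s=1..r. \<Phi> s q ^ a s)) (at q)"
    using Phi_D by (intro has_derivative_prod_power) auto
  ultimately have "((\<lambda>q. p q * (\<Prod>s=1..r. \<Phi> s q ^ a s)) has_real_derivative
      p q * ((\<Sum>s=1..r. real (a s) * u s) * (\<Prod>s=1..r. \<Phi> s q ^ a s)) +
      v * p q * (\<Prod>s=1..r. \<Phi> s q ^ a s)) (at q)"
    by (rule DERIV_mult')
  then have F_D: "(F has_real_derivative c * F q) (at q)"
    unfolding F_def[abs_def] c_def by (simp add: algebra_simps)
  then have c_eq: "c = der q0 F q / F q"
    using DERIV_unique[OF F_D increasing_C1_DERIV[OF F_C1 q]] Fq by (simp add: field_simps)
  \<comment> \<open>Differentiate \<open>m s * \<Phi> s = F\<close> and solve for the derivative of \<open>m s\<close>.\<close>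
  have m_der: "der q0 (\<Phi> s) q * (A * der q0 (m s) q) = A * F q * (u s * (c - u s))"
    if s: "s \<in> {1..r}" for s
  proof -
    have "((\<lambda>q. m s q * \<Phi> s q) has_real_derivative
        m s q * (u s * \<Phi> s q) + der q0 (m s) q * \<Phi> s q) (at q)"
      by (intro DERIV_mult' Phi_D s increasing_C1_DERIV m_C1 q)
    then have "m s q * (u s * \<Phi> s q) + der q0 (m s) q * \<Phi> s q = c * F q"
      unfolding m_mult_Phi[OF s] using DERIV_unique F_D by blast
    then have "der q0 (m s) q * \<Phi> s q = F q * (c - u s)"
      using m_mult_Phi[OF s, of q] by (simp add: algebra_simps)
    moreover have "der q0 (\<Phi> s) q = u s * \<Phi> s q" using pos(2)[OF s] by (simp add: u_def)
    ultimately show ?thesis by (simp add: mult_ac)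
  qed
  have g_eq: "g q = (\<Sum>s=1..r. real (a s) / A * sqrt (A * F q * (u s * (c - u s))))"
    unfolding g_def by (intro sum.cong refl) (simp only: m_der lam_eq)
  have u_nonneg: "0 \<le> u s" if "s \<in> {1..r}" for s
    using increasing_C1_der_nonneg[OF Phi_C1[OF that] q] pos(2)[OF that] by (simp add: u_def)
  have v_nonneg: "0 \<le> v" using increasing_C1_der_nonneg[OF p q] pos(1) by (simp add: v_def)
  have a_ge_1: "1 \<le> real (a s)" if "s \<in> {1..r}" for s using a_pos[OF that] by simp
  note bound_eq = sum_sqrt_bound[where S = "{1..r}" and a = "\<lambda>s. real (a s)" and u = u,
    OF finite_atLeastAtMost A_eq[symmetric] A_ge_2 a_ge_1 u_nonneg v_nonneg c_def Fq, folded g_eq]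
  have bound: "g q \<le> sqrt ((A - 1) / A) * (sqrt (F q) * c)"
    by (rule bound_eq(1))
  have eq: "A * u s = c"
    if "s \<in> {1..r}" "g q = sqrt ((A - 1) / A) * (sqrt (F q) * c)" for s
    by (rule bound_eq(2)[OF _ _ that(2,1)])
  have "(H has_real_derivative 2 * sqrt ((A - 1) / A) * (inverse (sqrt (F q)) / 2 * (c * F q))) (at q)"
    unfolding H_def[abs_def] by (intro DERIV_cmult DERIV_chain2[OF DERIV_real_sqrt F_D] Fq)
  also have "inverse (sqrt (F q)) / 2 * (c * F q) = sqrt (F q) * c / 2"
    using Fq by (simp add: field_simps)
  finally have "(H has_real_derivative sqrt ((A - 1) / A) * (sqrt (F q) * c)) (at q)" by simp
  from DERIV_diff[OF this integral_g_DERIV[OF q]]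
  have D_D: "(D has_real_derivative d) (at q)" unfolding D_def[abs_def] d_def .
  show ?thesis
  proof (rule that[OF D_D])
    show "0 \<le> d" using bound by (simp add: d_def)
    show balance: "A * (der q0 (\<Phi> s) q / \<Phi> s q) = der q0 F q / F q"
      if "d = 0" "s \<in> {1..r}" for s
      using eq[OF that(2)] that(1) by (simp add: d_def u_def c_eq)
    show "der q0 p q = 0" if "d = 0"
    proof -
      have "(\<Sum>s=1..r. real (a s) * u s) = (\<Sum>s=1..r. real (a s) * (c / A))"
      proof (intro sum.cong refl)
        fix s assume "s \<in> {1..r}"
        then have "A * u s = c" using balance[OF that] by (simp only: u_def c_eq)
        then have "u s = c / A" using A_ge_2 by (simp add: field_simps)
        then show "real (a s) * u s = real (a s) * (c / A)" by simp
      qed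
      also have "\<dots> = A * (c / A)" unfolding A_eq sum_distrib_right ..
      also have "\<dots> = c" using A_ge_2 by simp
      finally show ?thesis using pos(1) by (simp add: c_def v_def)
    qed
  qed
qed

text \<open>
  \<open>D\<close> need not be differentiable at the time \<open>z\<close> where \<open>F\<close> becomes positive, so the two sides of \<open>z\<close>
  are treated separately and joined by continuity.
\<close>

lemma D_mono:
  assumes xy: "q0 \<le> x" "x \<le> y" "y \<le> 1"
  shows "D x \<le> D y"
proof -
  obtain z where z: "z \<in> {q0..1}" "F z = 0 \<or> z = q0"
    "\<And>q. q0 \<le> q \<Longrightarrow> q < z \<Longrightarrow> F q = 0" "\<And>q. z < q \<Longrightarrow> q \<le> 1 \<Longrightarrow> 0 < F q"
    using increasing_C1_last_zero[OF F_C1] q0 by (metis less_imp_le)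
  have cont: "continuous_on {x..y} D" if "q0 \<le> x" "y \<le> 1" for x y
    using D_continuous that by (auto intro: continuous_on_subset)
  have left: "D x \<le> D y" if "q0 \<le> x" "x \<le> y" "y \<le> z" for x y
  proof (rule DERIV_nonneg_imp_increasing_open[where f = D])
    fix q assume "x < q" "q < y"
    then have "(D has_real_derivative 0) (at q)"
      using that z(1) by (intro D_DERIV_zero[of q z] z(3)) auto
    then show "\<exists>d. (D has_real_derivative d) (at q) \<and> 0 \<le> d" by auto
  qed (use that z(1) cont in auto)
  have right: "D x \<le> D y" if "z \<le> x" "x \<le> y" "y \<le> 1" for x y
  proof (rule DERIV_nonneg_imp_increasing_open[where f = D])
    fix q assume "x < q" "q < y"
    then have "q0 < q" "q < 1" "0 < F q" using that z(1) z(4)[of q] by auto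
    then show "\<exists>d. (D has_real_derivative d) (at q) \<and> 0 \<le> d"
      by (rule D_DERIV_pos) blast
  qed (use that z(1) cont in auto)
  consider "y \<le> z" | "z \<le> x" | "x \<le> z" "z \<le> y" by linarith
  then show ?thesis
    using left[of x y] right[of x y] left[of x z] right[of z y] xy by cases auto
qed

lemma D_q0: "D q0 = H q0" by (simp add: D_def)

lemma H_nonneg: "q \<in> {q0..1} \<Longrightarrow> 0 \<le> H q"
  using increasing_C1_range(1)[OF F_C1] A_ge_2 by (simp add: H_def)

lemma H_le: "q \<in> {q0..1} \<Longrightarrow> H q \<le> 2 * sqrt ((A - 1) / A)"
  using increasing_C1_range(2)[OF F_C1, of q] A_ge_2 
  by (simp add: H_def mult_left_le)

lemma alg_functional_le: "alg_functional r lam (pure_model r a) p \<Phi> q0 \<le> 2 * sqrt ((A - 1) / A)"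
  using D_mono[of q0 1] D_q0 H_nonneg[of q0] H_le[of 1] q0
  unfolding alg_functional_eq D_def by simp

lemma maximizer_unique:
  assumes eq: "alg_functional r lam (pure_model r a) p \<Phi> q0 = 2 * sqrt ((A - 1) / A)"
  shows "q0 = 0" "q \<in> {0..1} \<Longrightarrow> p q = 1" "q \<in> {0..1} \<Longrightarrow> s \<in> {1..r} \<Longrightarrow> \<Phi> s q = q"
proof -
  have D1: "D 1 \<le> 0" using H_le[of 1] q0 eq by (simp add: D_def alg_functional_eq)
  have Hq0: "H q0 = 0" using D_mono[of q0 1] D_q0 H_nonneg[of q0] D1 q0 by simp
  have D0: "D q = 0" if "q \<in> {q0..1}" for q
    using D_mono[of q0 q] D_mono[of q 1] D1 D_q0 Hq0 that by auto
  have Fq0: "F q0 = 0" using Hq0 A_ge_2 by (simp add: H_def)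
  have "H 1 = 2 * sqrt ((A - 1) / A)" using D0[of 1] q0 eq by (simp add: D_def alg_functional_eq)
  then have F1: "F 1 = 1" using A_ge_2 by (simp add: H_def)
  \<comment> \<open>Values in \<open>[0, 1]\<close> with weighted mean 1 are all equal to 1.\<close>
  have Phi1: "\<Phi> s 1 = 1" if s: "s \<in> {1..r}" for s
  proof -
    have "(\<Sum>s=1..r. lam s * \<Phi> s 1) = (\<Sum>s=1..r. lam s * 1)"
      using Phi_sum[of 1] lam_sum q0 by simp
    then have "lam s * \<Phi> s 1 = lam s * 1"
      by (rule sum_mono_inv)
        (use s q0 lam_pos increasing_C1_range(2)[OF Phi_C1, of _ 1] in \<open>auto simp: less_imp_le\<close>)
    then show ?thesis using lam_pos[OF s] by simp
  qed
  have p1: "p 1 = 1" using F1 Phi1 by (simp add: F_def)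
  obtain z where z: "z \<in> {q0..1}" "F z = 0 \<or> z = q0"
    "\<And>q. q0 \<le> q \<Longrightarrow> q < z \<Longrightarrow> F q = 0" "\<And>q. z < q \<Longrightarrow> q \<le> 1 \<Longrightarrow> 0 < F q"
    using increasing_C1_last_zero[OF F_C1] q0 by (metis less_imp_le)
  have Fz: "F z = 0" using z(2) Fq0 by auto
  then have z1: "z < 1" using F1 z(1) by (cases "z = 1") auto
  \<comment> \<open>On \<open>(z, 1)\<close> equality holds pointwise, because \<open>D\<close> is constant there.\<close>
  have rigid: "der q0 p q = 0" "\<And>s. s \<in> {1..r} \<Longrightarrow> q * der q0 (\<Phi> s) q = \<Phi> s q"
    if q: "z < q" "q < 1" for q
  proof -
    have q': "q0 < q" "0 < F q" using q z by auto
    obtain d where d: "(D has_real_derivative d) (at q)"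
      "\<And>s. d = 0 \<Longrightarrow> s \<in> {1..r} \<Longrightarrow> A * (der q0 (\<Phi> s) q / \<Phi> s q) = der q0 F q / F q"
      "d = 0 \<Longrightarrow> der q0 p q = 0"
      using D_DERIV_pos[OF q'(1) q(2) q'(2)] by metis
    have "(D has_real_derivative 0) (at q)"
      by (rule has_field_derivative_transform_within_open[of "\<lambda>_. 0" 0 q "{q0<..<1}"])
        (use q q' D0 in auto)
    then have d0: "d = 0" using d(1) DERIV_unique by blast
    show "der q0 p q = 0" by (rule d(3)[OF d0])
    \<comment> \<open>The common logarithmic derivative of all \<open>\<Phi> s\<close>.\<close>
    define k where "k = der q0 F q / F q / A"
    have k: "der q0 (\<Phi> s) q = k * \<Phi> s q" if s: "s \<in> {1..r}" for s
      using d(2)[OF d0 s] pos_factors(2)[OF _ q'(2) s] q q' A_ge_2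
      by (simp add: k_def field_simps)
    have "((\<lambda>q. \<Sum>s=1..r. lam s * \<Phi> s q) has_real_derivative (\<Sum>s=1..r. lam s * der q0 (\<Phi> s) q)) (at q)"
      by (intro DERIV_sum DERIV_cmult increasing_C1_DERIV Phi_C1 q q')
    then have "((\<lambda>q. q) has_real_derivative (\<Sum>s=1..r. lam s * der q0 (\<Phi> s) q)) (at q)"
      by (rule has_field_derivative_transform_within_open[where S = "{q0<..<1}"])
        (use q q' Phi_sum in auto)
    then have "1 = (\<Sum>s=1..r. lam s * der q0 (\<Phi> s) q)" by (rule DERIV_unique[OF DERIV_ident])
    also have "\<dots> = k * (\<Sum>s=1..r. lam s * \<Phi> s q)"
      unfolding sum_distrib_left by (intro sum.cong refl) (simp add: k)
    also have "\<dots> = k * q" using Phi_sum[of q] q q' by simp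
    finally show "q * der q0 (\<Phi> s) q = \<Phi> s q" if "s \<in> {1..r}" for s
      using k[OF that] by (metis mult.commute mult.left_commute mult_1)
  qed
  have cont: "continuous_on {q..1} f" if "f \<in> increasing_C1 q0" "z \<le> q" for f q
    using increasing_C1_continuous[OF that(1)] z(1) that(2) by (auto intro: continuous_on_subset)
  have p_eq: "p q = 1" if q: "z \<le> q" "q < 1" for q
  proof -
    have "p 1 = p q"
    proof (rule DERIV_isconst_end[OF q(2) cont[OF p q(1)]])
      fix x assume x: "q < x" "x < 1"
      then show "(p has_real_derivative 0) (at x)"
        using increasing_C1_DERIV[OF p, of x] rigid(1)[of x] q z(1) by auto
    qed
    then show ?thesis using p1 by simp
  qed
  have Phi_eq: "\<Phi> s q = q" if q: "z < q" "q < 1" and s: "s \<in> {1..r}" for q s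
  proof -
    have q_pos: "0 < q" using q z(1) q0 by auto
    have "\<Phi> s 1 / 1 = \<Phi> s q / q"
    proof (rule DERIV_isconst_end[OF q(2), where f = "\<lambda>x. \<Phi> s x / x"])
      show "continuous_on {q..1} (\<lambda>x. \<Phi> s x / x)"
        using q_pos q by (intro continuous_intros cont Phi_C1 s) auto
      fix x assume x: "q < x" "x < 1"
      have "((\<lambda>x. \<Phi> s x / x) has_real_derivative
          (der q0 (\<Phi> s) x * x - \<Phi> s x * 1) / (x * x)) (at x)"
        using x q z(1) q_pos by (intro DERIV_divide increasing_C1_DERIV Phi_C1 s DERIV_ident) auto
      then show "((\<lambda>x. \<Phi> s x / x) has_real_derivative 0) (at x)"
        using rigid(2)[OF _ x(2) s] x q by (simp add: mult.commute)
    qed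
    then show ?thesis using Phi1[OF s] q_pos by (simp add: field_simps)
  qed
  \<comment> \<open>Dividing by \<open>q\<close> is not possible at \<open>z\<close> if \<open>z = 0\<close>; continuity extends the identity to \<open>z\<close>.\<close>
  have Phi_z: "\<Phi> s z = z" if s: "s \<in> {1..r}" for s
  proof -
    have cl: "closure {z<..<1} = {z..1}" using z1 by simp
    have "\<Phi> s z - z = 0"
      by (rule continuous_constant_on_closure[of "{z<..<1}" "\<lambda>q. \<Phi> s q - q"])
        (unfold cl, use cont[OF Phi_C1[OF s] order_refl] Phi_eq[OF _ _ s] z1 in
          \<open>auto intro!: continuous_on_diff\<close>)
    then show ?thesis by simp
  qed
  have "F z = (\<Prod>s=1..r. z ^ a s)" using p_eq[of z] z1 Phi_z by (simp add: F_def)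
  then have z0: "z = 0" using Fz by simp
  then show q00: "q0 = 0" using z(1) q0 by simp
  show "p q = 1" if "q \<in> {0..1}" using p_eq[of q] p1 that z0 by (cases "q = 1") auto
  show "\<Phi> s q = q" if "q \<in> {0..1}" "s \<in> {1..r}"
    using Phi_eq[of q s] Phi1 Phi_z that z0 by (cases "q = 1"; cases "q = 0") auto
qed

end

section \<open>The diagonal path\<close>

lemma alg_functional_diagonal:
  assumes a: "\<And>s. s \<in> {1..r} \<Longrightarrow> a s > 0" and n: "n = (\<Sum>s=1..r. a s)" "2 \<le> n"
    and lam: "\<And>s. s \<in> {1..r} \<Longrightarrow> lam s = real (a s) / real n"
  shows "alg_functional r lam (pure_model r a) (\<lambda>_. 1) (\<lambda>s q. q) 0 = 2 * sqrt ((real n - 1) / real n)"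
proof -
  let ?h = "\<lambda>q. sqrt (real n * (real (n - 1) * q ^ (n - 2)))"
  have lam_sum: "(\<Sum>s=1..r. lam s) = 1"
  proof -
    have "(\<Sum>s=1..r. lam s) = (\<Sum>s=1..r. real (a s) / real n)" by (intro sum.cong refl lam)
    also have "\<dots> = real n / real n" by (simp only: sum_divide_distrib[symmetric] n(1) of_nat_sum)
    finally show ?thesis using n(2) by simp
  qed
  have xi: "xi_species lam (pure_model r a) s (\<lambda>t. u) = real n * u ^ (n - 1)"
    if s: "s \<in> {1..r}" for s u
  proof -
    have "(a s - 1) + (\<Sum>t\<in>{1..r}-{s}. a t) = n - 1"
      unfolding n(1) using sum.remove[OF _ s, of a] a[OF s] by simp
    then show ?thesis
      by (simp add: xi_species_pure_model[where lam = lam and a = a, OF s lam[OF s] a[OF s]]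
          power_sum[symmetric]
          power_add[symmetric])
  qed
  have integrand: "sqrt (der 0 (\<lambda>q. q) q * der 0 (\<lambda>u. 1 * xi_species lam (pure_model r a) s (\<lambda>t. u)) q)
      = ?h q" if s: "s \<in> {1..r}" and q: "q \<in> {0..1}" for s q
  proof -
    have "((\<lambda>u. real n * u ^ (n - 1)) has_real_derivative real n * (real (n - 1) * q ^ (n - 2)))
        (at q within {0..1})"
      using n(2) by (auto intro!: derivative_eq_intros simp: numeral_2_eq_2)
    then have "der 0 (\<lambda>u. real n * u ^ (n - 1)) q = real n * (real (n - 1) * q ^ (n - 2))"
      using q by (intro vector_derivative_within_closed_interval)
        (auto simp: has_real_derivative_iff_has_vector_derivative)
    moreover have "der 0 (\<lambda>q. q) q = 1"
      using q by (intro vector_derivative_within_closed_interval)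
        (auto simp: has_real_derivative_iff_has_vector_derivative[symmetric])
    ultimately show ?thesis by (simp add: xi[OF s])
  qed
  \<comment> \<open>The antiderivative is the potential \<open>2 * sqrt ((n - 1) / n) * sqrt F\<close> for \<open>F q = q ^ n\<close>.\<close>
  have "(?h has_integral 2 * sqrt ((real n - 1) / real n) * sqrt (1 ^ n)
      - 2 * sqrt ((real n - 1) / real n) * sqrt (0 ^ n)) {0..1}"
  proof (rule fundamental_theorem_of_calculus_interior)
    show "continuous_on {0..1} (\<lambda>q. 2 * sqrt ((real n - 1) / real n) * sqrt (q ^ n))"
      by (intro continuous_intros)
    fix q :: real assume q: "q \<in> {0<..<1}"
    then have q_pos: "0 < q" by simp
    obtain k where k: "n = k + 2" using n(2) le_Suc_ex by (metis add.commute)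
    let ?d = "2 * sqrt ((real n - 1) / real n) * (inverse (sqrt (q ^ n)) / 2 * (real n * q ^ (n - 1)))"
    have "((\<lambda>q. 2 * sqrt ((real n - 1) / real n) * sqrt (q ^ n)) has_real_derivative ?d) (at q)"
      using q_pos
      by (intro DERIV_cmult DERIV_chain2[OF DERIV_real_sqrt]) (auto intro!: derivative_eq_intros)
    moreover have "?d = ?h q"
    proof (rule power2_eq_imp_eq)
      have "2 * x * (inverse y / 2 * w) = x * (w / y)" for x y w :: real
        by (simp add: inverse_eq_divide)
      then have "?d = sqrt ((real n - 1) / real n) * (real n * q ^ (n - 1) / sqrt (q ^ n))"
        by blast
      also have "\<dots>\<^sup>2 = (real n - 1) / real n * ((real n)\<^sup>2 * (q ^ (n - 1))\<^sup>2 / q ^ n)"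
        using q_pos n(2) by (simp add: power_mult_distrib power_divide)
      also have "(q ^ (n - 1))\<^sup>2 = q ^ (n - 2) * q ^ n"
        by (simp add: k power2_eq_square mult_ac)
      also have "(real n - 1) / real n * ((real n)\<^sup>2 * (q ^ (n - 2) * q ^ n) / q ^ n) = (?h q)\<^sup>2"
        using q_pos k by (simp add: power2_eq_square)
      finally show "?d\<^sup>2 = (?h q)\<^sup>2" .
    qed (use q_pos n(2) in auto)
    ultimately show "((\<lambda>q. 2 * sqrt ((real n - 1) / real n) * sqrt (q ^ n)) has_vector_derivative ?h q) (at q)"
      by (simp add: has_real_derivative_iff_has_vector_derivative)
  qed simp
  then have int: "integral {0..1} ?h = 2 * sqrt ((real n - 1) / real n)"
    using n(2) by (simp add: integral_unique)
  have "alg_functional r lam (pure_model r a) (\<lambda>_. 1) (\<lambda>s q. q) 0 = (\<Sum>s=1..r. lam s * integral {0..1} ?h)"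
    unfolding alg_functional_def
    by (intro sum.cong refl arg_cong2[where f = "(*)"] integral_cong integrand)
  then show ?thesis by (simp only: int sum_distrib_right[symmetric] lam_sum mult_1)
qed

lemma id_increasing_C1: "(\<lambda>q. q) \<in> increasing_C1 0"
  unfolding increasing_C1_def by (auto simp: mono_on_def intro!: exI[of _ "\<lambda>_. 1"])

theorem corollary1p9:
  fixes r :: nat and a :: "nat \<Rightarrow> nat" and lam :: "nat \<Rightarrow> real"
  assumes "r \<ge> 2"
    and "\<forall>s\<in>{1..r}. a s > 0"
    and "\<forall>s\<in>{1..r}. lam s = real (a s) / real (\<Sum>s'=1..r. a s')"
  shows "uniquely_maximizes r lam (pure_model r a) (\<lambda>s q. q) \<and>
    ALG r lam (pure_model r a) =
      ereal (2 * sqrt ((real (\<Sum>s=1..r. a s) - 1) / real (\<Sum>s=1..r. a s)))"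
proof -
  define n where "n = (\<Sum>s=1..r. a s)"
  let ?C = "2 * sqrt ((real n - 1) / real n)"
  have a: "\<And>s. s \<in> {1..r} \<Longrightarrow> a s > 0" and lam: "\<And>s. s \<in> {1..r} \<Longrightarrow> lam s = real (a s) / real n"
    using assms by (auto simp: n_def)
  have "(\<Sum>s=1..r. 1) \<le> n" unfolding n_def using a by (intro sum_mono) (auto simp: Suc_le_eq)
  then have n2: "2 \<le> n" using assms(1) by simp
  have C_pos: "0 < ?C" using n2 by simp
  have path: "pure_path r a lam (real n) q0 p \<Psi>"
    if "q0 \<in> {0..1}" "q0 \<noteq> 1" "p \<in> increasing_C1 q0" "\<Psi> \<in> Adm r lam q0" for q0 p \<Psi>
  proof
    show "real n = (\<Sum>s=1..r. real (a s))" by (simp add: n_def)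
  qed (use that a lam n2 in auto)
  have trivial: "alg_functional r lam (pure_model r a) p \<Psi> 1 = 0" for p \<Psi>
    by (simp add: alg_functional_def)
  have le: "alg_functional r lam (pure_model r a) p \<Psi> q0 \<le> ?C"
    if "q0 \<in> {0..1}" "p \<in> increasing_C1 q0" "\<Psi> \<in> Adm r lam q0" for q0 p \<Psi>
    using pure_path.alg_functional_le[OF path] that trivial C_pos by (cases "q0 = 1") force+
  have diag: "alg_functional r lam (pure_model r a) (\<lambda>_. 1) (\<lambda>s q. q) 0 = ?C"
    by (rule alg_functional_diagonal[OF a n_def n2 lam])
  have lam_sum: "(\<Sum>s=1..r. lam s) = 1"
  proof -
    have "(\<Sum>s=1..r. lam s) = (\<Sum>s=1..r. real (a s) / real n)" by (intro sum.cong refl lam)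
    also have "\<dots> = real n / real n" by (simp only: sum_divide_distrib[symmetric] n_def of_nat_sum)
    finally show ?thesis using n2 by simp
  qed
  have adm: "(\<lambda>s q. q) \<in> Adm r lam 0"
  proof -
    have "(\<Sum>s=1..r. lam s * q) = q" for q
      by (simp only: sum_distrib_right[symmetric] lam_sum mult_1)
    then show ?thesis by (simp add: Adm_def id_increasing_C1)
  qed
  have ALG: "ALG r lam (pure_model r a) = ereal ?C"
  proof (rule antisym)
    show "ALG r lam (pure_model r a) \<le> ereal ?C"
      unfolding ALG_def using le by (auto intro!: SUP_least)
    have "ereal ?C \<le> (SUP (p, \<Phi>)\<in>increasing_C1 0 \<times> Adm r lam 0.
        ereal (alg_functional r lam (pure_model r a) p \<Phi> 0))"
      using adm diag increasing_C1_const[of 1]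
      by (intro SUP_upper2[of "(\<lambda>_. 1, \<lambda>s q. q)"]) auto
    also have "\<dots> \<le> ALG r lam (pure_model r a)"
      unfolding ALG_def by (rule SUP_upper) simp
    finally show "ereal ?C \<le> ALG r lam (pure_model r a)" .
  qed
  have "q0 = 0 \<and> (\<forall>q\<in>{0..1}. p q = 1) \<and> (\<forall>s\<in>{1..r}. \<forall>q\<in>{0..1}. \<Psi> s q = q)"
    if h: "q0 \<in> {0..1}" "p \<in> increasing_C1 q0" "\<Psi> \<in> Adm r lam q0"
      "alg_functional r lam (pure_model r a) p \<Psi> q0 = ?C" for q0 p \<Psi>
  proof -
    have "q0 \<noteq> 1" using trivial h(4) C_pos by force
    then show ?thesis using pure_path.maximizer_unique[OF path h(4)] h by blast
  qed
  then have "uniquely_maximizes r lam (pure_model r a) (\<lambda>s q. q)"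
    unfolding uniquely_maximizes_def ALG using adm diag by simp
  then show ?thesis using ALG by (simp only: n_def)
qed

end
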